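(* Let $M$ be a non-degenerate ruled surface in $\mathbb{E}_1^3$ parametrized by $X(s,t)=\gamma(s)+t\,w(s)$, where $\langle w(s),w(s)\rangle=\delta\in\{-1,1\}$ for all $s$. Assume that $w'(s)$ is not lightlike (for every $s$). If $M$ is a translating soliton with respect to a nonzero vector $\vec v\in\mathbb{E}_1^3$, then $M$ is a cylindrical surface or $M$ is (part of) a plane parallel to $\vec v$.
   Context: $\mathbb{E}_1^3$ is $\mathbb{R}^3$ with coordinates $(x,y,z)$ and metric $\langle\,,\rangle=dx^2+dy^2-dz^2$. A nonzero vector $a$ is spacelike, timelike or lightlike if $\langle a,a\rangle$ is $>0$, $<0$ or $=0$ (the zero vector is not lightlike). A (connected, smooth) surface $M$ is non-degenerate if its induced metric is non-degenerate. Let $N$ be a (local) unit normal field, $\epsilon=\langle N,N\rangle\in\{-1,1\}$, and $\sigma$ the second fundamental form, $\nabla^0_UV=\nabla_UV+\sigma(U,V)$. The mean curvature vector is $\vec H=\frac12\,\mathrm{trace}(\sigma)$ (trace with respect to the induced metric), and the mean curvature $H$ is defined by $\vec H=HN$. A translating soliton with respect to a nonzero vector $\vec v$ is a non-degenerate surface with $2H=\langle N,\vec v\rangle$ at every point. A ruled surface is parametrized by $X(s,t)=\gamma(s)+t\,w(s)$, $(s,t)\in I\times J$ with $I,J$ open intervals, where $\gamma$ is a smooth regular curve and $w$ is a smooth nowhere vanishing vector field along $\gamma$; the straight lines $t\mapsto X(s,t)$ are the rulings. It is cylindrical if all rulings are parallel to a fixed direction. A plane is parallel to $\vec v$ if $\vec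 v$ belongs to its direction plane. *)

theory Defs
  imports "HOL-Analysis.Analysis"
begin

text \<open>The space \<open>E\<^sub>1\<^sup>3\<close> is the type \<^typ>\<open>real^3\<close> together with the Lorentzian
  product \<open>lorentz\<close>; orthogonality, normals and lengths below always refer to this product and
  never to the Euclidean \<open>inner\<close>.\<close>

definition lorentz :: "real^3 \<Rightarrow> real^3 \<Rightarrow> real" where
  "lorentz a b = a$1 * b$1 + a$2 * b$2 - a$3 * b$3"

definition lightlike :: "real^3 \<Rightarrow> bool" where
  "lightlike a \<longleftrightarrow> a \<noteq> 0 \<and> lorentz a a = 0"

definition curve_deriv :: "(real \<Rightarrow> real^3) \<Rightarrow> real \<Rightarrow> real^3" where
  "curve_deriv c = (\<lambda>s. vector_derivative c (at s))"

text \<open>Class \<open>C\<^sup>\<infinity>\<close> on an open set: all iterated derivatives exist.\<close>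

definition smooth_curve_on :: "real set \<Rightarrow> (real \<Rightarrow> real^3) \<Rightarrow> bool" where
  "smooth_curve_on I c \<longleftrightarrow> (\<forall>n. \<forall>s\<in>I. (curve_deriv ^^ n) c differentiable (at s))"

text \<open>A parametrized surface is a map \<open>X\<close> from an open set of \<^typ>\<open>real^2\<close> to \<^typ>\<open>real^3\<close>.
  Its smoothness is not part of the definitions below (only of \<open>ruled_surface\<close>); the curvature
  quantities are meaningful for maps of class \<open>C\<^sup>2\<close>.\<close>

definition coord_deriv :: "2 \<Rightarrow> (real^2 \<Rightarrow> real^3) \<Rightarrow> real^2 \<Rightarrow> real^3" where
  "coord_deriv i X p = frechet_derivative X (at p) (axis i 1)"

definition tangent_plane :: "(real^2 \<Rightarrow> real^3) \<Rightarrow> real^2 \<Rightarrow> (real^3) set" where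
  "tangent_plane X p = range (frechet_derivative X (at p))"

definition nondegenerate_surface :: "(real^2) set \<Rightarrow> (real^2 \<Rightarrow> real^3) \<Rightarrow> bool" where
  "nondegenerate_surface U X \<longleftrightarrow>
     (\<forall>p\<in>U. X differentiable (at p) \<and> inj (frechet_derivative X (at p)) \<and>
       (\<forall>a\<in>tangent_plane X p. (\<forall>b\<in>tangent_plane X p. lorentz a b = 0) \<longrightarrow> a = 0))"

definition induced_metric :: "(real^2 \<Rightarrow> real^3) \<Rightarrow> real^2 \<Rightarrow> real^2^2" where
  "induced_metric X p = (\<chi> i j. lorentz (coord_deriv i X p) (coord_deriv j X p))"

text \<open>The unique decomposition into tangent and normal part exists at points where the induced
  metric is nondegenerate.\<close>

definition normal_part :: "(real^2 \<Rightarrow> real^3) \<Rightarrow> real^2 \<Rightarrow> real^3 \<Rightarrow> real^3" where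
  "normal_part X p z =
     (THE n. (\<forall>a\<in>tangent_plane X p. lorentz n a = 0) \<and> z - n \<in> tangent_plane X p)"

text \<open>The coefficients \<open>\<sigma>(X\<^sub>i, X\<^sub>j)\<close> of the second fundamental form on the coordinate
  fields, for which the flat connection gives \<open>\<partial>\<^sub>i \<partial>\<^sub>j X\<close>; by the Gauss formula \<open>\<sigma>\<close> is its normal
  part.\<close>

definition second_ff :: "(real^2 \<Rightarrow> real^3) \<Rightarrow> real^2 \<Rightarrow> 2 \<Rightarrow> 2 \<Rightarrow> real^3" where
  "second_ff X p i j = normal_part X p (coord_deriv i (coord_deriv j X) p)"

text \<open>Half of the metric trace \<open>\<Sum> g\<^sup>i\<^sup>j \<sigma>(X\<^sub>i, X\<^sub>j)\<close>.\<close>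

definition mean_curvature_vector :: "(real^2 \<Rightarrow> real^3) \<Rightarrow> real^2 \<Rightarrow> real^3" where
  "mean_curvature_vector X p =
     (1/2) *\<^sub>R (\<Sum>i\<in>UNIV. \<Sum>j\<in>UNIV. matrix_inv (induced_metric X p) $ i $ j *\<^sub>R second_ff X p i j)"

definition unit_normal :: "(real^2 \<Rightarrow> real^3) \<Rightarrow> real^2 \<Rightarrow> real^3 \<Rightarrow> bool" where
  "unit_normal X p N \<longleftrightarrow>
     (\<forall>a\<in>tangent_plane X p. lorentz N a = 0) \<and> lorentz N N \<in> {-1, 1}"

definition mean_curvature :: "(real^2 \<Rightarrow> real^3) \<Rightarrow> real^2 \<Rightarrow> real^3 \<Rightarrow> real" where
  "mean_curvature X p N = (THE H. mean_curvature_vector X p = H *\<^sub>R N)"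

text \<open>The value of \<open>H\<close> at a point depends only on the value of the unit normal field there, and
  replacing \<open>N\<close> by \<open>-N\<close> changes the sign of both sides, so the equation is imposed for
  either of the two unit normals at each point.\<close>

definition translating_soliton :: "(real^2) set \<Rightarrow> (real^2 \<Rightarrow> real^3) \<Rightarrow> real^3 \<Rightarrow> bool" where
  "translating_soliton U X v \<longleftrightarrow> nondegenerate_surface U X \<and>
     (\<forall>p\<in>U. \<forall>N. unit_normal X p N \<longrightarrow> 2 * mean_curvature X p N = lorentz N v)"

definition open_interval :: "real set \<Rightarrow> bool" where
  "open_interval I \<longleftrightarrow> open I \<and> is_interval I \<and> I \<noteq> {}"

definition param_domain :: "real set \<Rightarrow> real set \<Rightarrow> (real^2) set" where
  "param_domain I J = {p. p$1 \<in> I \<and> p$2 \<in> J}"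

definition ruled_map :: "(real \<Rightarrow> real^3) \<Rightarrow> (real \<Rightarrow> real^3) \<Rightarrow> real^2 \<Rightarrow> real^3" where
  "ruled_map \<gamma> w p = \<gamma> (p$1) + p$2 *\<^sub>R w (p$1)"

definition ruled_surface ::
    "real set \<Rightarrow> real set \<Rightarrow> (real \<Rightarrow> real^3) \<Rightarrow> (real \<Rightarrow> real^3) \<Rightarrow> bool" where
  "ruled_surface I J \<gamma> w \<longleftrightarrow> open_interval I \<and> open_interval J \<and>
     smooth_curve_on I \<gamma> \<and> (\<forall>s\<in>I. curve_deriv \<gamma> s \<noteq> 0) \<and>
     smooth_curve_on I w \<and> (\<forall>s\<in>I. w s \<noteq> 0)"

definition cylindrical :: "real set \<Rightarrow> (real \<Rightarrow> real^3) \<Rightarrow> bool" where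
  "cylindrical I w \<longleftrightarrow> (\<exists>u. u \<noteq> 0 \<and> (\<forall>s\<in>I. \<exists>c. w s = c *\<^sub>R u))"

definition plane_parallel_to :: "(real^3) set \<Rightarrow> real^3 \<Rightarrow> bool" where
  "plane_parallel_to P v \<longleftrightarrow>
     (\<exists>q D. subspace D \<and> dim D = 2 \<and> P = (+) q ` D \<and> v \<in> D)"

end

theory Submission
  imports Defs
begin

text \<open>
  Write \<open>x = \<gamma>' + t w'\<close>, \<open>m = x \<times> w\<close> with the Euclidean cross product, \<open>F = \<langle>x, w\<rangle>\<close> and
  \<open>D = \<langle>x, x\<rangle> \<delta> - F\<^sup>2\<close>. The vector \<open>m\<close> with its third coordinate reversed is a Lorentzian normal of
  Lorentzian norm \<open>-D\<close>, so after clearing square roots the soliton condition reads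
  \<open>\<delta> m \<bullet> (\<gamma>'' + t w'') - 2 F (m \<bullet> w') = - \<bar>D\<bar> (m \<bullet> v)\<close> (\<open>ruled_soliton_equation\<close>).

  For fixed \<open>s\<close> the left side has degree two in \<open>t\<close>. If \<open>w' \<noteq> 0\<close>, then \<open>\<langle>w', w'\<rangle> \<noteq> 0\<close>, so \<open>D\<close> has degree
  exactly two and the right side is, up to sign, a polynomial of degree at most three in \<open>t\<close>. Its cubic coefficient gives
  \<open>det(w', w, v) = 0\<close>, and the quadratic one then ties \<open>det(\<gamma>', w, v)\<close> to \<open>det(w', w, w'')\<close>
  (\<open>ruled_soliton_coefficients\<close>). Differentiating the first relation puts \<open>w''\<close> as well as \<open>w'\<close> into
  the plane of \<open>w\<close> and \<open>v\<close> if these are independent, which forces \<open>det(\<gamma>', w, v) = 0\<close> and \<open>det(\<gamma>', w, w') = 0\<close>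
  (\<open>noncylindrical_planar\<close>): where the ruling turns, the surface is planar and \<open>v\<close> is tangent to it.

  This does not yet exclude that planar pieces alternate with cylindrical ones, since \<open>w'\<close> may have
  zeros. But the relation \<open>det(\<gamma>', w, w') = 0\<close> is trivial where \<open>w' = 0\<close>, hence holds on all of \<open>I\<close>. With
  it, for a fixed \<open>t\<close>, the soliton equation makes \<open>m\<close> satisfy \<open>m' = k m + (m \<bullet> v) c\<close> with
  continuous \<open>k\<close> and \<open>c\<close>. So \<open>m \<bullet> v\<close> solves a homogeneous linear differential equation, and it vanishes
  at one point with \<open>w' \<noteq> 0\<close>; therefore it vanishes identically, \<open>m' = k m\<close>, and the direction of \<open>m\<close> is
  constant (\<open>normal_of_noncylindrical\<close>). The surface then lies in one plane, which contains the
  direction \<open>v\<close>. If there is no point with \<open>w' \<noteq> 0\<close>, then \<open>w\<close> is constant.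
\<close>

unbundle cross3_syntax

section \<open>Triple products and the Lorentzian product\<close>

lemma triple_product_cyclic: "(a \<times> b) \<bullet> c = (b \<times> c) \<bullet> a"
  by (simp add: cross3_simps)

text \<open>Three vectors orthogonal to a common nonzero vector are linearly dependent.\<close>

lemma triple_product_coplanar:
  fixes c :: "real^3"
  assumes "c \<noteq> 0" "c \<bullet> x = 0" "c \<bullet> y = 0" "c \<bullet> z = 0"
  shows "(x \<times> y) \<bullet> z = 0"
proof -
  have "((x \<times> y) \<bullet> z) *\<^sub>R c = (c \<bullet> z) *\<^sub>R (x \<times> y) + (c \<bullet> x) *\<^sub>R (y \<times> z) + (c \<bullet> y) *\<^sub>R (z \<times> x)"
    by (simp add: vec_eq_iff forall_3 cross_components inner_vec_def sum_3; intro conjI; algebra)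
  with assms show ?thesis by simp
qed

lemma orthogonal_to_cross_decomp:
  assumes "x \<times> y \<noteq> 0" "(x \<times> y) \<bullet> u = 0"
  shows "\<exists>a b. u = a *\<^sub>R x + b *\<^sub>R y"
proof -
  define m where "m = x \<times> y"
  have m: "m \<bullet> m \<noteq> 0" using assms by (simp add: m_def)
  \<comment> \<open>Cramer's rule for the basis \<open>x\<close>, \<open>y\<close>, \<open>m\<close>, whose determinant is \<open>m \<bullet> m\<close>.\<close>
  have "(m \<bullet> m) *\<^sub>R u = ((u \<times> y) \<bullet> m) *\<^sub>R x + ((x \<times> u) \<bullet> m) *\<^sub>R y + (m \<bullet> u) *\<^sub>R m"
    unfolding m_def
    by (simp add: vec_eq_iff forall_3 cross_components inner_vec_def sum_3; intro conjI; algebra)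
  then have "(m \<bullet> m) *\<^sub>R u = ((u \<times> y) \<bullet> m) *\<^sub>R x + ((x \<times> u) \<bullet> m) *\<^sub>R y"
    using assms(2) by (simp add: m_def)
  then have "(1 / (m \<bullet> m)) *\<^sub>R (m \<bullet> m) *\<^sub>R u
      = (1 / (m \<bullet> m)) *\<^sub>R (((u \<times> y) \<bullet> m) *\<^sub>R x + ((x \<times> u) \<bullet> m) *\<^sub>R y)" by simp
  then have "u = (((u \<times> y) \<bullet> m) / (m \<bullet> m)) *\<^sub>R x + (((x \<times> u) \<bullet> m) / (m \<bullet> m)) *\<^sub>R y"
    using m by (simp add: scaleR_add_right)
  then show ?thesis by blast
qed

text \<open>Moving one factor of the normal \<open>m = x \<times> y\<close> changes \<open>m\<close> along itself and, only as far as the moving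
  factor leaves the plane of \<open>x\<close> and \<open>y\<close>, in a tangential direction.\<close>

lemma cross_normal_variation:
  "((x \<times> y) \<bullet> (x \<times> y)) *\<^sub>R (z \<times> y) =
   ((z \<times> y) \<bullet> (x \<times> y)) *\<^sub>R (x \<times> y) + ((x \<times> y) \<bullet> z) *\<^sub>R ((x \<times> y) \<times> y)"
  by (simp add: vec_eq_iff forall_3 cross_components inner_vec_def sum_3; intro conjI; algebra)

lemma cross_normal_variation':
  "((x \<times> y) \<bullet> (x \<times> y)) *\<^sub>R (x \<times> z) =
   ((x \<times> z) \<bullet> (x \<times> y)) *\<^sub>R (x \<times> y) + ((x \<times> y) \<bullet> z) *\<^sub>R (x \<times> (x \<times> y))"
  by (simp add: vec_eq_iff forall_3 cross_components inner_vec_def sum_3; intro conjI; algebra)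

lemma lorentz_simps:
  "lorentz (a + b) c = lorentz a c + lorentz b c"
  "lorentz c (a + b) = lorentz c a + lorentz c b"
  "lorentz (a - b) c = lorentz a c - lorentz b c"
  "lorentz c (a - b) = lorentz c a - lorentz c b"
  "lorentz (r *\<^sub>R a) c = r * lorentz a c"
  "lorentz c (r *\<^sub>R a) = r * lorentz c a"
  "lorentz 0 c = 0" "lorentz c 0 = 0"
  by (simp_all add: lorentz_def algebra_simps)

lemma lorentz_commute: "lorentz a b = lorentz b a"
  by (simp add: lorentz_def algebra_simps)

text \<open>The reflection that turns Euclidean into Lorentzian orthogonality: triple products
  \<open>(x \<times> y) \<bullet> u\<close> become Lorentzian products of \<open>u\<close> with a normal of the plane spanned by \<open>x\<close> and \<open>y\<close>.\<close>

definition lorentz_dual :: "real^3 \<Rightarrow> real^3" where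
  "lorentz_dual m = vector [m$1, m$2, - m$3]"

lemma lorentz_dual [simp]: "lorentz (lorentz_dual m) u = m \<bullet> u"
  by (simp add: lorentz_def lorentz_dual_def inner_vec_def sum_3)

text \<open>Lagrange's identity for the Lorentzian product. The sign reflects that a plane with definite metric has
  a timelike normal.\<close>

lemma lorentz_dual_cross:
  "(x \<times> y) \<bullet> lorentz_dual (x \<times> y) = - (lorentz x x * lorentz y y - (lorentz x y)\<^sup>2)"
  by (simp add: lorentz_def lorentz_dual_def cross_components inner_vec_def sum_3; algebra)

lemma matrix_inv_2:
  fixes A :: "real^2^2"
  assumes "D = A$1$1 * A$2$2 - A$1$2 * A$2$1" "D \<noteq> 0"
  shows "matrix_inv A $1$1 = A$2$2 / D" "matrix_inv A $1$2 = - A$1$2 / D"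
    "matrix_inv A $2$1 = - A$2$1 / D" "matrix_inv A $2$2 = A$1$1 / D"
proof -
  define B :: "real^2^2" where
    "B = vector [vector [A$2$2 / D, - A$1$2 / D], vector [- A$2$1 / D, A$1$1 / D]]"
  have AB: "A ** B = mat 1" and BA: "B ** A = mat 1"
    using assms(2)
    by (simp_all add: matrix_matrix_mult_def B_def mat_def vec_eq_iff forall_2 sum_2
        divide_simps, simp_all add: assms(1) mult.commute)
  have "A ** matrix_inv A = mat 1 \<and> matrix_inv A ** A = mat 1"
    unfolding matrix_inv_def by (rule someI[of _ B]) (simp add: AB BA)
  then have "matrix_inv A = (B ** A) ** matrix_inv A" "A ** matrix_inv A = mat 1"
    using BA by simp_all
  then have "matrix_inv A = B"
    by (simp add: matrix_mul_assoc[symmetric])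
  then show "matrix_inv A $1$1 = A$2$2 / D" "matrix_inv A $1$2 = - A$1$2 / D"
    "matrix_inv A $2$1 = - A$2$1 / D" "matrix_inv A $2$2 = A$1$1 / D"
    by (simp_all add: B_def)
qed

section \<open>The soliton equation in a parametrization\<close>

locale nondegenerate_point =
  fixes X :: "real^2 \<Rightarrow> real^3" and p :: "real^2"
  assumes diff: "X differentiable (at p)"
    and inj: "inj (frechet_derivative X (at p))"
    and nondeg: "\<And>a. a \<in> tangent_plane X p \<Longrightarrow>
      (\<And>b. b \<in> tangent_plane X p \<Longrightarrow> lorentz a b = 0) \<Longrightarrow> a = 0"
begin


abbreviation "x \<equiv> coord_deriv 1 X p"
abbreviation "y \<equiv> coord_deriv 2 X p"
abbreviation "n \<equiv> lorentz_dual (x \<times> y)"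

definition W :: real where "W = lorentz x x * lorentz y y - (lorentz x y)\<^sup>2"

lemma frechet_derivative_coords: "frechet_derivative X (at p) h = h$1 *\<^sub>R x + h$2 *\<^sub>R y"
proof -
  have l: "linear (frechet_derivative X (at p))"
    using diff by (rule linear_frechet_derivative)
  have "h = h$1 *\<^sub>R axis 1 1 + h$2 *\<^sub>R axis 2 1"
    by (simp add: vec_eq_iff forall_2 axis_def)
  then have "frechet_derivative X (at p) h
      = frechet_derivative X (at p) (h$1 *\<^sub>R axis 1 1 + h$2 *\<^sub>R axis 2 1)" by simp
  then show ?thesis
    by (simp add: coord_deriv_def linear_add[OF l] linear_cmul[OF l])
qed

lemma tangent_plane_iff: "u \<in> tangent_plane X p \<longleftrightarrow> (\<exists>a b. u = a *\<^sub>R x + b *\<^sub>R y)"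
proof
  assume "\<exists>a b. u = a *\<^sub>R x + b *\<^sub>R y"
  then obtain a b where "u = a *\<^sub>R x + b *\<^sub>R y" by blast
  then have "u = frechet_derivative X (at p) (vector [a, b])"
    by (simp add: frechet_derivative_coords)
  then show "u \<in> tangent_plane X p" by (simp add: tangent_plane_def)
qed (auto simp: tangent_plane_def frechet_derivative_coords)

text \<open>If the Gram determinant vanished, \<open>\<langle>y, y\<rangle> x - \<langle>x, y\<rangle> y\<close> would be a tangent vector orthogonal to the tangent
  plane, hence zero; by independence \<open>\<langle>y, y\<rangle> = \<langle>x, y\<rangle> = 0\<close>, and then \<open>y\<close> itself would be such a vector.\<close>

lemma gram_nonzero: "W \<noteq> 0"
proof
  assume W: "W = 0"
  have indep: "a = 0 \<and> b = 0" if "a *\<^sub>R x + b *\<^sub>R y = 0" for a b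
  proof -
    have "frechet_derivative X (at p) (vector [a, b]) = frechet_derivative X (at p) 0"
      using that by (simp add: frechet_derivative_coords)
    then have "vector [a, b] = (0 :: real^2)" using inj by (simp add: inj_eq)
    then show ?thesis by (simp add: vec_eq_iff forall_2)
  qed
  have null: "lorentz y y *\<^sub>R x + (- lorentz x y) *\<^sub>R y = 0"
  proof (rule nondeg)
    fix u assume "u \<in> tangent_plane X p"
    then obtain a b where "u = a *\<^sub>R x + b *\<^sub>R y" by (auto simp: tangent_plane_iff)
    then have "lorentz (lorentz y y *\<^sub>R x + (- lorentz x y) *\<^sub>R y) u = a * W"
      by (simp add: lorentz_simps lorentz_commute[of y x] algebra_simps power2_eq_square W_def)
    with W show "lorentz (lorentz y y *\<^sub>R x + (- lorentz x y) *\<^sub>R y) u = 0" by simp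
  qed (unfold tangent_plane_iff, metis)
  have yy: "lorentz y y = 0" and xy: "lorentz x y = 0" using indep[OF null] by auto
  have "0 *\<^sub>R x + 1 *\<^sub>R y = 0"
  proof (rule nondeg)
    fix u assume "u \<in> tangent_plane X p"
    then show "lorentz (0 *\<^sub>R x + 1 *\<^sub>R y) u = 0"
      using yy xy by (auto simp: tangent_plane_iff lorentz_simps lorentz_commute[of y x])
  qed (unfold tangent_plane_iff, blast)
  with indep[of 0 1] show False by simp
qed

lemma normal_norm: "(x \<times> y) \<bullet> n = - W"
  unfolding W_def by (rule lorentz_dual_cross)

lemma normal_orthogonal: "u \<in> tangent_plane X p \<Longrightarrow> (x \<times> y) \<bullet> u = 0"
  by (auto simp: tangent_plane_iff inner_right_distrib dot_cross_self inner_commute)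

lemma cross_nonzero: "x \<times> y \<noteq> 0"
  using gram_nonzero normal_norm by auto

lemma normal_part_eq: "normal_part X p z = (- ((x \<times> y) \<bullet> z) / W) *\<^sub>R n"
  unfolding normal_part_def
proof (rule the_equality)
  define c where "c = - ((x \<times> y) \<bullet> z) / W"
  have "(x \<times> y) \<bullet> (z - c *\<^sub>R n) = (x \<times> y) \<bullet> z - c * - W"
    by (simp only: inner_diff_right inner_scaleR_right normal_norm)
  then have "(x \<times> y) \<bullet> (z - c *\<^sub>R n) = 0"
    using gram_nonzero by (simp add: c_def)
  then have tan: "z - c *\<^sub>R n \<in> tangent_plane X p"
    using orthogonal_to_cross_decomp[OF cross_nonzero] tangent_plane_iff by blast
  show c: "(\<forall>a\<in>tangent_plane X p. lorentz (c *\<^sub>R n) a = 0) \<and> z - c *\<^sub>R n \<in> tangent_plane X p"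
    using tan by (simp add: lorentz_simps normal_orthogonal)
  fix k assume k: "(\<forall>a\<in>tangent_plane X p. lorentz k a = 0) \<and> z - k \<in> tangent_plane X p"
  have "subspace (tangent_plane X p)"
    unfolding tangent_plane_def
    using linear_subspace_image[OF linear_frechet_derivative[OF diff] subspace_UNIV] .
  then have "(z - c *\<^sub>R n) - (z - k) \<in> tangent_plane X p"
    using subspace_diff tan k by blast
  then have "k - c *\<^sub>R n = 0"
    using k c by (intro nondeg) (auto simp: lorentz_simps)
  then show "k = c *\<^sub>R n" by simp
qed

lemma mean_curvature_vector_eq:
  "mean_curvature_vector X p = - ((x \<times> y) \<bullet>
     (lorentz y y *\<^sub>R coord_deriv 1 (coord_deriv 1 X) p
      - lorentz x y *\<^sub>R (coord_deriv 1 (coord_deriv 2 X) p + coord_deriv 2 (coord_deriv 1 X) p)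
      + lorentz x x *\<^sub>R coord_deriv 2 (coord_deriv 2 X) p) / (2 * W\<^sup>2)) *\<^sub>R n"
proof -
  have W: "W = induced_metric X p$1$1 * induced_metric X p$2$2
      - induced_metric X p$1$2 * induced_metric X p$2$1"
    by (simp add: W_def induced_metric_def power2_eq_square lorentz_commute[of y x])
  note inv = matrix_inv_2[OF W gram_nonzero]
  have trace: "(1/2) *\<^sub>R ((G / D) *\<^sub>R (- a / D) *\<^sub>R k + (- F / D) *\<^sub>R (- b / D) *\<^sub>R k
        + ((- F / D) *\<^sub>R (- c / D) *\<^sub>R k + (E / D) *\<^sub>R (- d / D) *\<^sub>R k))
      = - ((G * a - F * (b + c) + E * d) / (2 * D\<^sup>2)) *\<^sub>R k"
    if "D \<noteq> 0" for a b c d D E F G and k :: "real^3"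
  proof -
    have "(1/2) * ((G / D) * (- a / D) + (- F / D) * (- b / D)
        + ((- F / D) * (- c / D) + (E / D) * (- d / D)))
      = - ((G * a - F * (b + c) + E * d) / (2 * D\<^sup>2))"
      using that by (simp add: field_simps power2_eq_square)
    then show ?thesis by (simp only: scaleR_scaleR scaleR_add_left[symmetric])
  qed
  have g: "induced_metric X p$1$1 = lorentz x x" "induced_metric X p$1$2 = lorentz x y"
    "induced_metric X p$2$1 = lorentz x y" "induced_metric X p$2$2 = lorentz y y"
    by (simp_all add: induced_metric_def lorentz_commute[of y x])
  show ?thesis
    unfolding mean_curvature_vector_def second_ff_def sum_2 normal_part_eq inv g
      trace[OF gram_nonzero] inner_add_right inner_diff_right inner_scaleR_right ..
qed

text \<open>The soliton condition with the unit normal eliminated. For \<open>N = n / sqrt \<bar>W\<bar>\<close> the mean curvature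
  acquires a factor \<open>sqrt \<bar>W\<bar>\<close> and \<open>\<langle>N, v\<rangle>\<close> its reciprocal, so that only \<open>\<bar>W\<bar>\<close> survives.\<close>

lemma soliton_equation:
  assumes "\<And>N. unit_normal X p N \<Longrightarrow> 2 * mean_curvature X p N = lorentz N v"
  shows "(x \<times> y) \<bullet>
     (lorentz y y *\<^sub>R coord_deriv 1 (coord_deriv 1 X) p
      - lorentz x y *\<^sub>R (coord_deriv 1 (coord_deriv 2 X) p + coord_deriv 2 (coord_deriv 1 X) p)
      + lorentz x x *\<^sub>R coord_deriv 2 (coord_deriv 2 X) p) = - \<bar>W\<bar> * ((x \<times> y) \<bullet> v)"
    (is "?L = _")
proof -
  define r where "r = sqrt \<bar>W\<bar>"
  have r: "r \<noteq> 0" "r * r = \<bar>W\<bar>" using gram_nonzero by (auto simp: r_def)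
  define N where "N = (1 / r) *\<^sub>R n"
  have "lorentz N N = - W / \<bar>W\<bar>"
    using r by (simp add: N_def lorentz_simps normal_norm)
  moreover have "- D / \<bar>D\<bar> \<in> {-1, 1}" if "D \<noteq> 0" for D :: real
    using that by (auto simp: abs_if)
  ultimately have "lorentz N N \<in> {-1, 1}" using gram_nonzero by metis
  then have N: "unit_normal X p N"
    by (simp add: unit_normal_def N_def lorentz_simps normal_orthogonal)
  have n0: "n \<noteq> 0" using gram_nonzero normal_norm by auto
  define L where "L = ?L"
  have "mean_curvature X p N = - (L / (2 * W\<^sup>2)) * r"
    unfolding mean_curvature_def mean_curvature_vector_eq L_def[symmetric]
  proof (rule the_equality)
    show "- (L / (2 * W\<^sup>2)) *\<^sub>R n = (- (L / (2 * W\<^sup>2)) * r) *\<^sub>R N"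
      using r by (simp add: N_def)
    fix H assume "- (L / (2 * W\<^sup>2)) *\<^sub>R n = H *\<^sub>R N"
    then have "- (L / (2 * W\<^sup>2)) = H / r"
      using n0 unfolding N_def scaleR_scaleR scaleR_cancel_right by simp
    then show "H = - (L / (2 * W\<^sup>2)) * r" using r by simp
  qed
  with assms[OF N] have "- (L / W\<^sup>2) * r = ((x \<times> y) \<bullet> v) / r"
    by (simp add: N_def lorentz_simps)
  then have "- (L / W\<^sup>2) * (r * r) = (x \<times> y) \<bullet> v"
    using r(1) by (simp add: field_simps)
  then have "(- L) * \<bar>W\<bar> = (((x \<times> y) \<bullet> v) * \<bar>W\<bar>) * \<bar>W\<bar>"
    using gram_nonzero unfolding r(2) by (simp add: field_simps power2_eq_square)
  then have "- L = ((x \<times> y) \<bullet> v) * \<bar>W\<bar>"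
    using gram_nonzero unfolding mult_cancel_right by simp
  then show ?thesis unfolding L_def[symmetric] by (metis minus_minus mult.commute mult_minus_left)
qed

end

section \<open>Linear differential equations\<close>

text \<open>Multiplying by the integrating factor \<open>exp (- K)\<close>, with \<open>K\<close> an antiderivative of \<open>k\<close> on the segment between
  the two points, makes \<open>g\<close> constant there.\<close>

lemma linear_ode_zero:
  fixes g k :: "real \<Rightarrow> real"
  assumes I: "is_interval I" and k: "continuous_on I k"
    and g: "\<And>s. s \<in> I \<Longrightarrow> (g has_real_derivative k s * g s) (at s)"
    and s0: "s0 \<in> I" "g s0 = 0" and s: "s \<in> I"
  shows "g s = 0"
proof -
  define S where "S = closed_segment s0 s"
  have S: "S \<subseteq> I" "convex S" "s0 \<in> S" "s \<in> S"
    using closed_segment_subset[OF s0(1) s] I by (auto simp: S_def is_interval_convex_1)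
  obtain a b where ab: "S = {a..b}" unfolding S_def closed_segment_eq_real_ivl by metis
  have "continuous_on {a..b} k" using continuous_on_subset[OF k S(1)] ab by simp
  then obtain K where K: "\<And>x. x \<in> {a..b} \<Longrightarrow> (K has_vector_derivative k x) (at x within {a..b})"
    using antiderivative_continuous by blast
  have "((\<lambda>x. g x * exp (- K x)) has_field_derivative 0) (at x within S)" if "x \<in> S" for x
  proof -
    have "(K has_real_derivative k x) (at x within S)"
      using K that ab by (simp add: has_real_derivative_iff_has_vector_derivative)
    moreover have "(g has_real_derivative k x * g x) (at x within S)"
      using g that S(1) has_field_derivative_at_within by blast
    ultimately show ?thesis
      by (auto intro!: derivative_eq_intros simp: algebra_simps)
  qed
  from has_field_derivative_zero_constant[OF S(2) this]
  obtain c where "\<And>x. x \<in> S \<Longrightarrow> g x * exp (- K x) = c" by blast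
  from this[OF S(3)] this[OF S(4)] s0(2) show ?thesis by simp
qed

section \<open>Derivatives of curves and of ruled maps\<close>

lemma open_nonzero_set:
  fixes f :: "'a::topological_space \<Rightarrow> 'b::{t1_space, zero}"
  assumes "open S" "continuous_on S f"
  shows "open {s\<in>S. f s \<noteq> 0}"
proof -
  have "{s\<in>S. f s \<noteq> 0} = S \<inter> f -` (- {0})" by auto
  then show ?thesis using continuous_open_preimage[OF assms(2,1), of "- {0}"] by auto
qed

lemmas bounded_bilinear_cross = bilinear_cross[unfolded bilinear_conv_bounded_bilinear]

lemmas has_vector_derivative_cross [derivative_intros] =
  bounded_bilinear.has_vector_derivative[OF bounded_bilinear_cross]

lemmas has_vector_derivative_inner =
  bounded_bilinear.has_vector_derivative[OF bounded_bilinear_inner]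

lemma has_real_derivative_inner_const:
  assumes "(c has_vector_derivative c') (at s)"
  shows "((\<lambda>s. c s \<bullet> u) has_real_derivative c' \<bullet> u) (at s)"
  using has_vector_derivative_inner[OF assms has_vector_derivative_const[of u]]
  by (simp add: has_real_derivative_iff_has_vector_derivative)

lemma bounded_bilinear_lorentz: "bounded_bilinear lorentz"
  unfolding bilinear_conv_bounded_bilinear[symmetric] bilinear_def
  by (auto intro!: linearI simp: lorentz_simps)

lemmas has_vector_derivative_lorentz =
  bounded_bilinear.has_vector_derivative[OF bounded_bilinear_lorentz]

lemmas continuous_on_lorentz [continuous_intros] =
  bounded_bilinear.continuous_on[OF bounded_bilinear_lorentz]

lemma smooth_curve_on_curve_deriv:
  assumes "smooth_curve_on I c"
  shows "smooth_curve_on I (curve_deriv c)"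
  unfolding smooth_curve_on_def
proof (intro allI ballI)
  fix n s assume "s \<in> I"
  with assms have "(curve_deriv ^^ Suc n) c differentiable (at s)"
    unfolding smooth_curve_on_def by blast
  then show "(curve_deriv ^^ n) (curve_deriv c) differentiable (at s)"
    by (simp add: funpow_swap1)
qed

lemma smooth_curve_on_has_derivative:
  assumes "smooth_curve_on I c" "s \<in> I"
  shows "(c has_vector_derivative curve_deriv c s) (at s)"
proof -
  have "(curve_deriv ^^ 0) c differentiable (at s)"
    using assms unfolding smooth_curve_on_def by blast
  then show ?thesis by (simp add: curve_deriv_def vector_derivative_works)
qed

lemma smooth_curve_on_continuous:
  assumes "smooth_curve_on I c"
  shows "continuous_on I c"
  using smooth_curve_on_has_derivative[OF assms] has_vector_derivative_continuous
  by (blast intro: continuous_at_imp_continuous_on)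

lemma has_derivative_ruled_map:
  assumes "(\<gamma> has_vector_derivative \<gamma>') (at (p$1))" "(w has_vector_derivative w') (at (p$1))"
  shows "(ruled_map \<gamma> w has_derivative
    (\<lambda>h. h$1 *\<^sub>R (\<gamma>' + p$2 *\<^sub>R w') + h$2 *\<^sub>R w (p$1))) (at p)"
proof -
  have nth: "((\<lambda>p. p$i) has_derivative (\<lambda>h. h$i)) (at p)" for i :: 2
    by (rule bounded_linear_imp_has_derivative) (rule bounded_linear_vec_nth)
  have c: "((\<lambda>p. c (p$1)) has_derivative (\<lambda>h. h$1 *\<^sub>R c')) (at p)"
    if "(c has_vector_derivative c') (at (p$1))" for c and c' :: "real^3"
    using has_derivative_compose[OF nth[of 1], of c "\<lambda>r. r *\<^sub>R c'"] that
    by (simp add: has_vector_derivative_def)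
  have "((\<lambda>p. \<gamma> (p$1) + p$2 *\<^sub>R w (p$1)) has_derivative
      (\<lambda>h. h$1 *\<^sub>R \<gamma>' + (p$2 *\<^sub>R (h$1 *\<^sub>R w') + h$2 *\<^sub>R w (p$1)))) (at p)"
    by (intro has_derivative_add has_derivative_scaleR c nth assms)
  moreover have "ruled_map \<gamma> w = (\<lambda>p. \<gamma> (p$1) + p$2 *\<^sub>R w (p$1))"
    by (rule ext) (simp add: ruled_map_def)
  ultimately show ?thesis by (simp add: algebra_simps)
qed

lemma coord_deriv_ruled_map:
  assumes "smooth_curve_on I \<gamma>" "smooth_curve_on I w" "p$1 \<in> I"
  shows "coord_deriv 1 (ruled_map \<gamma> w) p = ruled_map (curve_deriv \<gamma>) (curve_deriv w) p"
    and "coord_deriv 2 (ruled_map \<gamma> w) p = w (p$1)"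
    and "ruled_map \<gamma> w differentiable (at p)"
proof -
  note D = has_derivative_ruled_map[OF assms(1,2)[THEN smooth_curve_on_has_derivative, OF assms(3)]]
  show "coord_deriv 1 (ruled_map \<gamma> w) p = ruled_map (curve_deriv \<gamma>) (curve_deriv w) p"
    and "coord_deriv 2 (ruled_map \<gamma> w) p = w (p$1)"
    unfolding coord_deriv_def frechet_derivative_at[OF D, symmetric]
    by (simp_all add: ruled_map_def axis_def)
  show "ruled_map \<gamma> w differentiable (at p)" using D unfolding differentiable_def by blast
qed

lemma coord_deriv_cong:
  assumes "open U" "p \<in> U" "\<And>q. q \<in> U \<Longrightarrow> f q = g q" "g differentiable (at p)"
  shows "coord_deriv i f p = coord_deriv i g p"
  unfolding coord_deriv_def
  using frechet_derivative_transform_within_open[OF assms(4,1,2), of f] assms(3) by simp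

lemma open_param_domain:
  assumes "open I" "open J"
  shows "open (param_domain I J)"
proof -
  have "param_domain I J = (\<lambda>p. p$1) -` I \<inter> (\<lambda>p. p$2) -` J"
    by (auto simp: param_domain_def)
  then show ?thesis
    using assms by (simp add: open_Int open_vimage continuous_on_component)
qed

text \<open>The coordinate derivatives of a ruled map are again ruled maps, with base curve and director
  \<open>(\<gamma>', w')\<close> and \<open>(w, 0)\<close>, so the formulas of first order apply twice.\<close>

lemma coord_deriv2_ruled_map:
  assumes "open I" "smooth_curve_on I \<gamma>" "smooth_curve_on I w" "p$1 \<in> I"
  shows "coord_deriv 1 (coord_deriv 1 (ruled_map \<gamma> w)) p
      = ruled_map (curve_deriv (curve_deriv \<gamma>)) (curve_deriv (curve_deriv w)) p"
    and "coord_deriv 2 (coord_deriv 1 (ruled_map \<gamma> w)) p = curve_deriv w (p$1)"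
    and "coord_deriv 1 (coord_deriv 2 (ruled_map \<gamma> w)) p = curve_deriv w (p$1)"
    and "coord_deriv 2 (coord_deriv 2 (ruled_map \<gamma> w)) p = 0"
proof -
  define U where "U = param_domain I (UNIV :: real set)"
  have U: "open U" "p \<in> U" "\<And>q. q \<in> U \<Longrightarrow> q$1 \<in> I"
    using assms open_param_domain[OF assms(1) open_UNIV] by (auto simp: U_def param_domain_def)
  note smooth = assms(2,3)[THEN smooth_curve_on_curve_deriv]
  have 1: "coord_deriv i (coord_deriv 1 (ruled_map \<gamma> w)) p
      = coord_deriv i (ruled_map (curve_deriv \<gamma>) (curve_deriv w)) p" for i
    by (rule coord_deriv_cong[OF U(1,2)])
      (use coord_deriv_ruled_map[OF assms(2,3)] coord_deriv_ruled_map(3)[OF smooth] U in auto)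
  have zero: "smooth_curve_on I (\<lambda>_. 0)"
  proof -
    have "curve_deriv (\<lambda>_. 0) = (\<lambda>_. 0)" by (simp add: curve_deriv_def)
    then have "(curve_deriv ^^ n) (\<lambda>_. 0) = (\<lambda>_. 0)" for n by (induction n) auto
    then show ?thesis by (simp add: smooth_curve_on_def)
  qed
  have 2: "coord_deriv i (coord_deriv 2 (ruled_map \<gamma> w)) p
      = coord_deriv i (ruled_map w (\<lambda>_. 0)) p" for i
    by (rule coord_deriv_cong[OF U(1,2)])
      (use coord_deriv_ruled_map[OF assms(2,3)] coord_deriv_ruled_map(3)[OF assms(3) zero] U
        in \<open>auto simp: ruled_map_def\<close>)
  show "coord_deriv 1 (coord_deriv 1 (ruled_map \<gamma> w)) p
      = ruled_map (curve_deriv (curve_deriv \<gamma>)) (curve_deriv (curve_deriv w)) p"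
    "coord_deriv 2 (coord_deriv 1 (ruled_map \<gamma> w)) p = curve_deriv w (p$1)"
    unfolding 1 coord_deriv_ruled_map[OF smooth assms(4)] by (rule refl)+
  show "coord_deriv 1 (coord_deriv 2 (ruled_map \<gamma> w)) p = curve_deriv w (p$1)"
    "coord_deriv 2 (coord_deriv 2 (ruled_map \<gamma> w)) p = 0"
    unfolding 2 coord_deriv_ruled_map[OF assms(3) zero assms(4)]
    by (simp_all add: ruled_map_def curve_deriv_def)
qed

section \<open>Ruled translating solitons\<close>

lemma cubic_vanishing:
  fixes a0 a1 a2 a3 :: real
  assumes "infinite S" "\<And>t. t \<in> S \<Longrightarrow> a0 + a1 * t + a2 * t\<^sup>2 + a3 * t ^ 3 = 0"
  shows "a2 = 0" "a3 = 0"
proof -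
  have "S \<subseteq> {t. poly [:a0, a1, a2, a3:] t = 0}"
    using assms(2) by (auto simp: algebra_simps power2_eq_square power3_eq_cube)
  then have "[:a0, a1, a2, a3:] = 0"
    using assms(1) poly_roots_finite finite_subset by blast
  then show "a2 = 0" "a3 = 0" by simp_all
qed

locale ruled_soliton =
  fixes I J :: "real set" and \<gamma> w :: "real \<Rightarrow> real^3" and v :: "real^3" and \<delta> :: real
  assumes ruled: "ruled_surface I J \<gamma> w"
    and \<delta>: "\<delta> \<in> {-1, 1}"
    and ww: "s \<in> I \<Longrightarrow> lorentz (w s) (w s) = \<delta>"
    and not_lightlike: "s \<in> I \<Longrightarrow> \<not> lightlike (curve_deriv w s)"
    and v: "v \<noteq> 0"
    and soliton: "translating_soliton (param_domain I J) (ruled_map \<gamma> w) v"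
begin

abbreviation "\<gamma>1 \<equiv> curve_deriv \<gamma>"
abbreviation "\<gamma>2 \<equiv> curve_deriv \<gamma>1"
abbreviation "w1 \<equiv> curve_deriv w"
abbreviation "w2 \<equiv> curve_deriv w1"

lemma open_I: "open I" and interval_I: "is_interval I"
  and open_J: "open J" and J_nonempty: "J \<noteq> {}"
  and smooth_\<gamma>: "smooth_curve_on I \<gamma>" and smooth_w: "smooth_curve_on I w"
  using ruled by (auto simp: ruled_surface_def open_interval_def)

lemma derivs:
  assumes "s \<in> I"
  shows "(\<gamma> has_vector_derivative \<gamma>1 s) (at s)" "(\<gamma>1 has_vector_derivative \<gamma>2 s) (at s)"
    "(w has_vector_derivative w1 s) (at s)" "(w1 has_vector_derivative w2 s) (at s)"
  by (rule smooth_curve_on_has_derivative[OF _ assms] smooth_curve_on_curve_deriv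
      smooth_\<gamma> smooth_w)+

lemma continuous:
  "continuous_on I \<gamma>1" "continuous_on I \<gamma>2" "continuous_on I w" "continuous_on I w1"
  "continuous_on I w2"
  by (rule smooth_curve_on_continuous smooth_curve_on_curve_deriv smooth_\<gamma> smooth_w)+

lemma lorentz_w_w1:
  assumes "s \<in> I"
  shows "lorentz (w s) (w1 s) = 0"
proof -
  have "((\<lambda>s. lorentz (w s) (w s)) has_vector_derivative
      lorentz (w s) (w1 s) + lorentz (w1 s) (w s)) (at s)"
    by (rule has_vector_derivative_lorentz derivs assms)+
  then have "((\<lambda>s. \<delta>) has_vector_derivative lorentz (w s) (w1 s) + lorentz (w1 s) (w s)) (at s)"
    by (rule has_vector_derivative_transform_within_open[OF _ open_I assms]) (simp add: ww)
  then have "lorentz (w s) (w1 s) + lorentz (w1 s) (w s) = 0"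
    using vector_derivative_unique_at has_vector_derivative_const by blast
  then show ?thesis by (simp add: lorentz_commute[of "w1 s"])
qed

text \<open>The determinant \<open>D\<close> of the induced metric at parameters \<open>(s, t)\<close>. The mixed coefficient is independent of \<open>t\<close>
  because \<open>\<langle>w', w\<rangle> = 0\<close>.\<close>

definition gram :: "real \<Rightarrow> real \<Rightarrow> real" where
  "gram t s = lorentz (\<gamma>1 s + t *\<^sub>R w1 s) (\<gamma>1 s + t *\<^sub>R w1 s) * \<delta> - (lorentz (\<gamma>1 s) (w s))\<^sup>2"

lemma nondegenerate_point:
  assumes "s \<in> I" "t \<in> J"
  shows "nondegenerate_point (ruled_map \<gamma> w) (vector [s, t])"
proof -
  have "vector [s, t] \<in> param_domain I J" using assms by (simp add: param_domain_def)
  then show ?thesis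
    using soliton unfolding translating_soliton_def nondegenerate_surface_def
    by unfold_locales blast+
qed

lemma ruled_soliton_equation:
  assumes s: "s \<in> I" and t: "t \<in> J"
  shows "gram t s \<noteq> 0"
    and "(\<gamma>1 s + t *\<^sub>R w1 s) \<times> w s \<noteq> 0"
    and "\<delta> * (((\<gamma>1 s + t *\<^sub>R w1 s) \<times> w s) \<bullet> (\<gamma>2 s + t *\<^sub>R w2 s))
      - 2 * lorentz (\<gamma>1 s) (w s) * (((\<gamma>1 s + t *\<^sub>R w1 s) \<times> w s) \<bullet> w1 s)
      = - \<bar>gram t s\<bar> * (((\<gamma>1 s + t *\<^sub>R w1 s) \<times> w s) \<bullet> v)"
proof -
  define p :: "real^2" where "p = vector [s, t]"
  interpret nondegenerate_point "ruled_map \<gamma> w" p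
    unfolding p_def by (rule nondegenerate_point[OF s t])
  have p: "p$1 = s" "p$2 = t" "p$1 \<in> I" "p \<in> param_domain I J"
    using s t by (auto simp: p_def param_domain_def)
  note d = coord_deriv_ruled_map(1,2)[OF smooth_\<gamma> smooth_w p(3)]
    coord_deriv2_ruled_map[OF open_I smooth_\<gamma> smooth_w p(3)]
  have F: "lorentz (\<gamma>1 s + t *\<^sub>R w1 s) (w s) = lorentz (\<gamma>1 s) (w s)"
    by (simp add: lorentz_simps lorentz_commute[of "w1 s"] lorentz_w_w1 s)
  have W: "W = gram t s"
    using s by (simp add: W_def gram_def d p ruled_map_def F ww)
  show "gram t s \<noteq> 0" using gram_nonzero W by simp
  show "(\<gamma>1 s + t *\<^sub>R w1 s) \<times> w s \<noteq> 0"
    using cross_nonzero by (simp add: d p ruled_map_def)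
  have "2 * mean_curvature (ruled_map \<gamma> w) p N = lorentz N v"
    if "unit_normal (ruled_map \<gamma> w) p N" for N
    using soliton that p(4) unfolding translating_soliton_def by blast
  from soliton_equation[OF this]
  show "\<delta> * (((\<gamma>1 s + t *\<^sub>R w1 s) \<times> w s) \<bullet> (\<gamma>2 s + t *\<^sub>R w2 s))
      - 2 * lorentz (\<gamma>1 s) (w s) * (((\<gamma>1 s + t *\<^sub>R w1 s) \<times> w s) \<bullet> w1 s)
      = - \<bar>gram t s\<bar> * (((\<gamma>1 s + t *\<^sub>R w1 s) \<times> w s) \<bullet> v)"
    using ww[OF s]
    unfolding W d p ruled_map_def F inner_add_right inner_diff_right inner_scaleR_right
    by simp
qed

text \<open>The absolute value of the Gram determinant is not polynomial in \<open>t\<close>, but one of the two signs occurs for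
  infinitely many \<open>t\<close>, which is enough to compare coefficients.\<close>

lemma ruled_soliton_coefficients:
  assumes s: "s \<in> I" and nz: "w1 s \<noteq> 0"
  shows "(w1 s \<times> w s) \<bullet> v = 0"
    and "(w1 s \<times> w s) \<bullet> w2 s = 0 \<Longrightarrow> (\<gamma>1 s \<times> w s) \<bullet> v = 0"
proof -
  have C: "lorentz (w1 s) (w1 s) \<noteq> 0" using not_lightlike[OF s] nz by (simp add: lightlike_def)
  have "infinite J" using open_J J_nonempty using finite_imp_not_open by blast
  moreover have "J = {t\<in>J. gram t s > 0} \<union> {t\<in>J. gram t s < 0}"
    using ruled_soliton_equation(1)[OF s] by force
  ultimately have "infinite {t\<in>J. gram t s > 0} \<or> infinite {t\<in>J. gram t s < 0}"
    by (metis finite_Un)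
  then obtain \<kappa> :: real where \<kappa>: "\<kappa> \<noteq> 0" and inf: "infinite {t\<in>J. \<bar>gram t s\<bar> = \<kappa> * gram t s}"
  proof
    assume "infinite {t\<in>J. gram t s > 0}"
    then have "infinite {t\<in>J. \<bar>gram t s\<bar> = 1 * gram t s}"
      by (rule contrapos_nn) (auto elim: rev_finite_subset)
    then show ?thesis using that[of 1] by simp
  next
    assume "infinite {t\<in>J. gram t s < 0}"
    then have "infinite {t\<in>J. \<bar>gram t s\<bar> = (-1) * gram t s}"
      by (rule contrapos_nn) (auto elim: rev_finite_subset)
    then show ?thesis using that[of "-1"] by simp
  qed
  define A B C F q r where "A = lorentz (\<gamma>1 s) (\<gamma>1 s)" and "B = lorentz (\<gamma>1 s) (w1 s)"
    and "C = lorentz (w1 s) (w1 s)" and "F = lorentz (\<gamma>1 s) (w s)"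
    and "q = (\<gamma>1 s \<times> w s) \<bullet> v" and "r = (w1 s \<times> w s) \<bullet> v"
  \<comment> \<open>The equation is \<open>\<delta> (a0 + a1 t + a2 t\<^sup>2) - 2 F e = - \<kappa> D (q + r t)\<close> with \<open>D = \<delta> (A + 2 B t + C t\<^sup>2) - F\<^sup>2\<close>.\<close>
  define a0 a1 a2 e where "a0 = (\<gamma>1 s \<times> w s) \<bullet> \<gamma>2 s"
    and "a1 = (\<gamma>1 s \<times> w s) \<bullet> w2 s + (w1 s \<times> w s) \<bullet> \<gamma>2 s"
    and "a2 = (w1 s \<times> w s) \<bullet> w2 s" and "e = (\<gamma>1 s \<times> w s) \<bullet> w1 s"
  have gram: "gram t s = \<delta> * (A + 2 * B * t + C * t\<^sup>2) - F\<^sup>2" for t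
    by (simp add: gram_def A_def B_def C_def F_def lorentz_simps lorentz_commute[of "w1 s" "\<gamma>1 s"]
        algebra_simps power2_eq_square)
  have coeffs: "(\<delta> * a0 - 2 * F * e + \<kappa> * (\<delta> * A - F\<^sup>2) * q)
     + (\<delta> * a1 + \<kappa> * (2 * \<delta> * B * q + (\<delta> * A - F\<^sup>2) * r)) * t
     + (\<delta> * a2 + \<kappa> * \<delta> * (C * q + 2 * B * r)) * t\<^sup>2
     + (\<kappa> * \<delta> * C * r) * t ^ 3 = 0"
    if t: "t \<in> {t\<in>J. \<bar>gram t s\<bar> = \<kappa> * gram t s}" for t
  proof -
    have "\<delta> * (a0 + a1 * t + a2 * t\<^sup>2) - 2 * F * e = - (\<kappa> * gram t s) * (q + r * t)"
      using ruled_soliton_equation(3)[OF s, of t] t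
      by (simp add: cross_add_left cross_mult_left inner_add_left inner_add_right
          a0_def a1_def a2_def F_def q_def r_def e_def dot_cross_self algebra_simps power2_eq_square)
    then show ?thesis unfolding gram by (simp add: algebra_simps power2_eq_square power3_eq_cube)
  qed
  note zero = cubic_vanishing[OF inf coeffs]
  have r: "r = 0" using zero(2) \<kappa> \<delta> C by (auto simp: C_def)
  then show "(w1 s \<times> w s) \<bullet> v = 0" by (simp add: r_def)
  show "(\<gamma>1 s \<times> w s) \<bullet> v = 0" if "(w1 s \<times> w s) \<bullet> w2 s = 0"
    using zero(1) r that \<kappa> \<delta> C by (auto simp: C_def a2_def q_def)
qed

text \<open>If \<open>w\<close> and \<open>v\<close> are independent, the vector \<open>w \<times> v\<close> is orthogonal to \<open>w\<close>, \<open>w'\<close> and \<open>w''\<close>, and then to \<open>\<gamma>'\<close> too,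
  so all triple products among these vectors vanish. If \<open>w\<close> and \<open>v\<close> are parallel at a point where the
  last conclusion fails, it fails on a neighbourhood, where \<open>w\<close> must then stay parallel to \<open>v\<close>; so
  \<open>w'\<close> is parallel to \<open>v\<close>, and \<open>w \<times> w' = 0\<close>, which makes the triple product vanish after all.\<close>

lemma noncylindrical_planar:
  assumes s: "s \<in> I" and nz: "w1 s \<noteq> 0"
  shows "(w2 s \<times> w s) \<bullet> v = 0" "(\<gamma>1 s \<times> w s) \<bullet> v = 0" "(\<gamma>1 s \<times> w s) \<bullet> w1 s = 0"
proof -
  define V where "V = {s\<in>I. w1 s \<noteq> 0}"
  have V_open: "open V"
    unfolding V_def by (rule open_nonzero_set[OF open_I continuous(4)])
  have in_V: "s \<in> V" using s nz by (simp add: V_def)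
  have w1v: "(w1 s \<times> w s) \<bullet> v = 0" if "s \<in> V" for s
    using ruled_soliton_coefficients(1) that by (simp add: V_def)
  have w2v: "(w2 s \<times> w s) \<bullet> v = 0" if s: "s \<in> V" for s
  proof -
    have sI: "s \<in> I" using s by (simp add: V_def)
    have "((\<lambda>s. (w1 s \<times> w s) \<bullet> v) has_real_derivative (w1 s \<times> w1 s + w2 s \<times> w s) \<bullet> v) (at s)"
      by (intro has_real_derivative_inner_const has_vector_derivative_cross derivs sI)
    moreover have "((\<lambda>s. (w1 s \<times> w s) \<bullet> v) has_real_derivative 0) (at s)"
      by (rule has_field_derivative_transform_within_open[OF DERIV_const V_open s])
        (simp add: w1v)
    ultimately have "(w1 s \<times> w1 s + w2 s \<times> w s) \<bullet> v = 0" by (rule DERIV_unique)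
    then show ?thesis by simp
  qed
  show "(w2 s \<times> w s) \<bullet> v = 0" using w2v[OF in_V] .
  have perp: "(w s \<times> v) \<bullet> z = (z \<times> w s) \<bullet> v" for s z
    by (rule triple_product_cyclic[symmetric])
  have qv: "(\<gamma>1 s \<times> w s) \<bullet> v = 0" if s: "s \<in> V" for s
  proof (cases "w s \<times> v = 0")
    case True
    then show ?thesis using perp[of s "\<gamma>1 s"] by simp
  next
    case False
    have "(w1 s \<times> w s) \<bullet> w2 s = 0"
      by (rule triple_product_coplanar[OF False])
        (simp_all only: perp w2v[OF s] w1v[OF s] cross_refl inner_zero_left)
    then show ?thesis using ruled_soliton_coefficients(2) s by (simp add: V_def)
  qed
  show "(\<gamma>1 s \<times> w s) \<bullet> v = 0" using qv[OF in_V] .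
  have generic: "(\<gamma>1 s \<times> w s) \<bullet> w1 s = 0" if "s \<in> V" "w s \<times> v \<noteq> 0" for s
    by (rule triple_product_coplanar[OF that(2)])
      (simp_all only: perp qv[OF that(1)] w1v[OF that(1)] cross_refl inner_zero_left)
  show "(\<gamma>1 s \<times> w s) \<bullet> w1 s = 0"
  proof (rule ccontr)
    assume ne: "(\<gamma>1 s \<times> w s) \<bullet> w1 s \<noteq> 0"
    define V' where "V' = {s\<in>V. (\<gamma>1 s \<times> w s) \<bullet> w1 s \<noteq> 0}"
    have "continuous_on V (\<lambda>s. (\<gamma>1 s \<times> w s) \<bullet> w1 s)"
      by (intro continuous_on_inner continuous_on_cross continuous_on_subset[OF continuous(1)]
          continuous_on_subset[OF continuous(3)] continuous_on_subset[OF continuous(4)])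
        (auto simp: V_def)
    then have open': "open V'"
      unfolding V'_def by (rule open_nonzero_set[OF V_open])
    have parallel: "w s \<times> v = 0" if "s \<in> V'" for s
      using generic[of s] that unfolding V'_def by blast
    have "s \<in> V'" using ne in_V by (simp add: V'_def)
    have "((\<lambda>s. w s \<times> v) has_vector_derivative w s \<times> 0 + w1 s \<times> v) (at s)"
      by (intro has_vector_derivative_cross has_vector_derivative_const derivs s)
    moreover have "((\<lambda>s. w s \<times> v) has_vector_derivative 0) (at s)"
      by (rule has_vector_derivative_transform_within_open[OF has_vector_derivative_const open' \<open>s \<in> V'\<close>])
        (rule parallel[symmetric])
    ultimately have "w s \<times> 0 + w1 s \<times> v = 0" by (rule vector_derivative_unique_at)
    then have "w1 s \<times> v = 0" by simp
    moreover have "w s \<times> v = 0" using parallel \<open>s \<in> V'\<close> by blast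
    \<comment> \<open>The expansion of \<open>w \<times> w'\<close> along \<open>v\<close> and orthogonally to it.\<close>
    moreover have "(v \<bullet> v) *\<^sub>R (w s \<times> w1 s)
      = (v \<bullet> w1 s) *\<^sub>R (w s \<times> v) - (v \<bullet> w s) *\<^sub>R (w1 s \<times> v)
        - ((w s \<times> v) \<bullet> w1 s) *\<^sub>R v"
      by (simp add: vec_eq_iff forall_3 cross_components inner_vec_def sum_3; intro conjI; algebra)
    ultimately have "w s \<times> w1 s = 0" using v by simp
    with ne show False using triple_product_cyclic[of "\<gamma>1 s"] by simp
  qed
qed
section \<open>Constancy of the tangent plane\<close>

text \<open>At a fixed \<open>t\<close>, the normal stays orthogonal to \<open>v\<close>, and its orthogonal complement is the same for all \<open>s\<close>,
  provided that the ruling turns somewhere: linear differential equations carry the information at that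
  point across the zeros of \<open>w'\<close>.\<close>

lemma normal_of_noncylindrical:
  assumes s0: "s0 \<in> I" "w1 s0 \<noteq> 0" and t: "t \<in> J"
  defines "m \<equiv> \<lambda>s. (\<gamma>1 s + t *\<^sub>R w1 s) \<times> w s"
  shows "\<And>s. s \<in> I \<Longrightarrow> m s \<bullet> v = 0"
    and "\<And>s s' u. s \<in> I \<Longrightarrow> s' \<in> I \<Longrightarrow> m s \<bullet> u = 0 \<Longrightarrow> m s' \<bullet> u = 0"
proof -
  define x where "x = (\<lambda>s. \<gamma>1 s + t *\<^sub>R w1 s)"
  define x1 where "x1 = (\<lambda>s. \<gamma>2 s + t *\<^sub>R w2 s)"
  define m1 where "m1 = (\<lambda>s. x s \<times> w1 s + x1 s \<times> w s)"
  have m: "m = (\<lambda>s. x s \<times> w s)" by (simp add: m_def x_def)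
  have x_deriv: "(x has_vector_derivative x1 s) (at s)" if "s \<in> I" for s
    unfolding x_def x1_def
    by (rule has_vector_derivative_add derivs that
        bounded_linear.has_vector_derivative[OF bounded_linear_scaleR_right])+
  have m_deriv: "(m has_vector_derivative m1 s) (at s)" if "s \<in> I" for s
    unfolding m m1_def by (intro has_vector_derivative_cross x_deriv derivs that)
  have m_nz: "m s \<bullet> m s \<noteq> 0" if "s \<in> I" for s
    using ruled_soliton_equation(2)[OF that t] by (simp add: m_def)
  \<comment> \<open>Trivial where \<open>w' = 0\<close>; elsewhere it is the planarity relation.\<close>
  have m_w1: "m s \<bullet> w1 s = 0" if "s \<in> I" for s
    using noncylindrical_planar(3)[OF that]
    by (cases "w1 s = 0")
      (simp_all add: m_def cross_add_left cross_mult_left inner_add_left dot_cross_self)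
  \<comment> \<open>The soliton equation without its mixed term, solved for \<open>m \<bullet> x'\<close> by means of \<open>\<delta>\<^sup>2 = 1\<close>.\<close>
  have m_x1: "m s \<bullet> x1 s = - (\<delta> * \<bar>gram t s\<bar>) * (m s \<bullet> v)" if "s \<in> I" for s
  proof -
    have "\<delta> * (m s \<bullet> x1 s) = - \<bar>gram t s\<bar> * (m s \<bullet> v)"
      using ruled_soliton_equation(3)[OF that t] m_w1[OF that] by (simp add: m_def x1_def)
    then show ?thesis using \<delta> by auto
  qed
  define k where "k = (\<lambda>s. (m1 s \<bullet> m s) / (m s \<bullet> m s))"
  have m1: "m1 s = k s *\<^sub>R m s + ((m s \<bullet> x1 s) / (m s \<bullet> m s)) *\<^sub>R (m s \<times> w s)"
    if "s \<in> I" for s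
  proof -
    have "(m s \<bullet> m s) *\<^sub>R m1 s = (m1 s \<bullet> m s) *\<^sub>R m s + (m s \<bullet> x1 s) *\<^sub>R (m s \<times> w s)"
      using cross_normal_variation[of "x s" "w s" "x1 s"]
        cross_normal_variation'[of "x s" "w s" "w1 s"] m_w1[OF that]
      by (simp add: m m1_def scaleR_add_right scaleR_add_left inner_add_left)
    then have "(1 / (m s \<bullet> m s)) *\<^sub>R (m s \<bullet> m s) *\<^sub>R m1 s
      = (1 / (m s \<bullet> m s)) *\<^sub>R ((m1 s \<bullet> m s) *\<^sub>R m s + (m s \<bullet> x1 s) *\<^sub>R (m s \<times> w s))" by simp
    then show ?thesis using m_nz[OF that] by (simp add: k_def scaleR_add_right)
  qed
  have cont: "continuous_on I m" "continuous_on I m1" "continuous_on I (gram t)"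
    unfolding m m1_def gram_def x_def x1_def
    by (intro continuous_intros continuous_on_cross continuous)+
  have cont_k: "continuous_on I k"
    unfolding k_def by (intro continuous_intros cont) (use m_nz in auto)
  \<comment> \<open>The coefficient in \<open>(m \<bullet> v)' = l (m \<bullet> v)\<close>, obtained from the decomposition of \<open>m'\<close> and the value of \<open>m \<bullet> x'\<close>.\<close>
  define l where
    "l = (\<lambda>s. k s + (- (\<delta> * \<bar>gram t s\<bar>) / (m s \<bullet> m s)) * ((m s \<times> w s) \<bullet> v))"
  have cont_l: "continuous_on I l"
    unfolding l_def
    by (intro continuous_intros continuous_on_cross cont cont_k continuous) (use m_nz in auto)
  have "m s0 \<bullet> v = 0"
    using noncylindrical_planar(2)[OF s0] ruled_soliton_coefficients(1)[OF s0]
    by (simp add: m_def cross_add_left cross_mult_left inner_add_left)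
  moreover have "((\<lambda>s. m s \<bullet> v) has_real_derivative l s * (m s \<bullet> v)) (at s)" if "s \<in> I" for s
  proof -
    have "m1 s \<bullet> v = l s * (m s \<bullet> v)"
      unfolding m1[OF that] m_x1[OF that] l_def by (simp add: inner_add_left algebra_simps)
    then show ?thesis using has_real_derivative_inner_const[OF m_deriv[OF that], of v] by simp
  qed
  ultimately show mv: "m s \<bullet> v = 0" if "s \<in> I" for s
    using linear_ode_zero[OF interval_I cont_l, of "\<lambda>s. m s \<bullet> v" s0 s] s0(1) that by blast
  have "((\<lambda>s. m s \<bullet> u) has_real_derivative k s * (m s \<bullet> u)) (at s)" if "s \<in> I" for s u
    using has_real_derivative_inner_const[OF m_deriv[OF that], of u]
    unfolding m1[OF that] m_x1[OF that] mv[OF that] by simp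
  then show "m s' \<bullet> u = 0" if "s \<in> I" "s' \<in> I" "m s \<bullet> u = 0" for s s' u
    using linear_ode_zero[OF interval_I cont_k, of "\<lambda>s. m s \<bullet> u" s s'] that by blast
qed

text \<open>With a constant tangent plane along the curve \<open>\<gamma> + t w\<close>, that curve lies in a plane of this direction,
  and so do the rulings through its points.\<close>

lemma noncylindrical_in_plane:
  assumes s0: "s0 \<in> I" "w1 s0 \<noteq> 0"
  shows "\<exists>P. plane_parallel_to P v \<and> ruled_map \<gamma> w ` param_domain I J \<subseteq> P"
proof -
  obtain t where t: "t \<in> J" using J_nonempty by blast
  define x where "x = (\<lambda>s. \<gamma>1 s + t *\<^sub>R w1 s)"
  define \<beta> where "\<beta> = (\<lambda>s. \<gamma> s + t *\<^sub>R w s)"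
  define a where "a = x s0 \<times> w s0"
  note normal = normal_of_noncylindrical[OF s0 t]
  have a_nz: "a \<noteq> 0" using ruled_soliton_equation(2)[OF s0(1) t] by (simp add: a_def x_def)
  have av: "a \<bullet> v = 0" using normal(1)[OF s0(1)] by (simp add: a_def x_def)
  have ax: "a \<bullet> x s = 0" and aw: "a \<bullet> w s = 0" if "s \<in> I" for s
    using normal(2)[OF that s0(1)] dot_cross_self
    by (metis a_def x_def inner_commute)+
  \<comment> \<open>Constancy, as the linear equation with coefficient zero.\<close>
  have a\<beta>: "\<beta> s \<bullet> a - \<beta> s0 \<bullet> a = 0" if "s \<in> I" for s
  proof (rule linear_ode_zero[OF interval_I continuous_on_const[of _ 0] _ s0(1) _ that])
    fix s assume s: "s \<in> I"
    have "(\<beta> has_vector_derivative x s) (at s)"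
      unfolding \<beta>_def x_def
      by (rule has_vector_derivative_add derivs s
          bounded_linear.has_vector_derivative[OF bounded_linear_scaleR_right])+
    from has_real_derivative_inner_const[OF this, of a] ax[OF s]
    show "((\<lambda>s. \<beta> s \<bullet> a - \<beta> s0 \<bullet> a) has_real_derivative 0 * (\<beta> s \<bullet> a - \<beta> s0 \<bullet> a)) (at s)"
      by (auto intro!: derivative_eq_intros simp: inner_commute)
  qed simp
  define D where "D = {u. a \<bullet> u = 0}"
  have "plane_parallel_to ((+) (\<beta> s0) ` D) v"
    unfolding plane_parallel_to_def
  proof (intro exI conjI)
    show "subspace D" unfolding D_def by (rule subspace_hyperplane)
    show "dim D = 2" unfolding D_def using dim_hyperplane[OF a_nz] by simp
  qed (use av in \<open>simp_all add: D_def\<close>)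
  moreover have "ruled_map \<gamma> w p \<in> (+) (\<beta> s0) ` D" if "p \<in> param_domain I J" for p
  proof
    show "ruled_map \<gamma> w p = \<beta> s0 + (\<beta> (p$1) - \<beta> s0 + (p$2 - t) *\<^sub>R w (p$1))"
      by (simp add: ruled_map_def \<beta>_def algebra_simps)
    show "\<beta> (p$1) - \<beta> s0 + (p$2 - t) *\<^sub>R w (p$1) \<in> D"
      using a\<beta>[of "p$1"] aw[of "p$1"] that
      by (simp add: D_def param_domain_def inner_add_right inner_diff_right inner_commute)
  qed
  ultimately show ?thesis by blast
qed

lemma cylindrical_if_stationary:
  assumes "\<And>s. s \<in> I \<Longrightarrow> w1 s = 0"
  shows "cylindrical I w"
proof -
  obtain s0 where s0: "s0 \<in> I" using ruled by (auto simp: ruled_surface_def open_interval_def)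
  have "\<exists>c. \<forall>s\<in>I. w s = c"
  proof (rule has_derivative_zero_constant)
    show "convex I" using interval_I by (simp add: is_interval_convex_1)
    show "(w has_derivative (\<lambda>_. 0)) (at s within I)" if "s \<in> I" for s
      using derivs(3)[OF that] assms[OF that]
      by (simp add: has_vector_derivative_def has_derivative_at_withinI)
  qed
  then have "\<forall>s\<in>I. w s = 1 *\<^sub>R w s0" using s0 by auto
  moreover have "w s0 \<noteq> 0" using ruled s0 by (simp add: ruled_surface_def)
  ultimately show ?thesis unfolding cylindrical_def by blast
qed

end

theorem theorem4p2:
  fixes I J :: "real set" and \<gamma> w :: "real \<Rightarrow> real^3" and v :: "real^3" and \<delta> :: real
  assumes "ruled_surface I J \<gamma> w"
    and "nondegenerate_surface (param_domain I J) (ruled_map \<gamma> w)"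
    and "\<delta> \<in> {-1, 1}"
    and "\<forall>s\<in>I. lorentz (w s) (w s) = \<delta>"
    and "\<forall>s\<in>I. \<not> lightlike (curve_deriv w s)"
    and "v \<noteq> 0"
    and "translating_soliton (param_domain I J) (ruled_map \<gamma> w) v"
  shows "cylindrical I w \<or>
    (\<exists>P. plane_parallel_to P v \<and> ruled_map \<gamma> w ` param_domain I J \<subseteq> P)"
proof -
  interpret ruled_soliton I J \<gamma> w v \<delta>
    using assms by unfold_locales auto
  show ?thesis using cylindrical_if_stationary noncylindrical_in_plane by blast
qed

end
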